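(* Let $q$ be a prime power, $\varepsilon_N=1/q$, and $\varepsilon_K\in[0,1)$. There exists a hash-based two-sided filter scheme in the random-oracle model with the following property as $n\to\infty$. When initialized on any key set $\mathcal K\subseteq\mathcal U$ with $|\mathcal K|=n$, it uses $$\mathrm{KL}\big(\mathrm{Bern}(1-\varepsilon_K)\,\big\|\,\mathrm{Bern}(\varepsilon_N)\big)+o(1)\ \text{ bits of space per key},$$ and, with probability $1-o(1)$, the resulting filter satisfies false negative rate at most $\varepsilon_K$ on the keys and false positive rate equal to $\varepsilon_N$ on every non-key. The guarantee is uniform over all universe sizes $u=|\mathcal U|\ge n$ (the $o(1)$ terms depend only on $n,\varepsilon_K,\varepsilon_N$, not on $u$ or on $\mathcal K$).
   Context: $\mathrm{KL}$ is the Kullback–Leibler divergence in bits (base-2 logarithm) and $\mathrm{Bern}(a)$ is the Bernoulli distribution with $\Pr[1]=a$. Filter in the random-oracle model. The universe is $\mathcal U=[u]$. The scheme has access, at no space cost, to a random hash function $h$ on $\mathcal U$ whose values $h(i)$, $i\in\mathcal U$, are independent and uniform on a finite set (which may depend on $n,\varepsilon_K,\varepsilon_N$). Initialization takes $\mathcal K\subseteq\mathcal U$ of size $n$ and the values $\{h(i)\}_{i\in\mathcal K}$, and outputs a binary string $W$, whose length is the space used (it is the total space divided by $n$ that is the space per key). A query on $i\in\mathcal U$ outputs a bit in $\{0,1\}$ computed from $W$ and $h(i)$, where 1 means "accepted as a key". The success probability $1-o(1)$ is over the values $\{h(i)\}_{i\in\mathcal K}$. On success: false negative rate at most $\varepsilon_K$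 means that for a uniformly random key $i'\sim\mathrm{Unif}(\mathcal K)$ the query returns 0 with probability at most $\varepsilon_K$ (i.e. at most $\varepsilon_K n$ of the keys are rejected); false positive rate equal to $\varepsilon_N$ on a non-key $i'\in\mathcal U\setminus\mathcal K$ means that, conditionally on $W$ (a function of $\mathcal K$ and $\{h(i)\}_{i\in\mathcal K}$), the query on $i'$ returns 1 with probability exactly $\varepsilon_N$ over $h(i')$. *)

theory Defs
  imports "HOL-Probability.Probability" "HOL-Number_Theory.Prime_Powers"
begin

text \<open>
  The KL divergence of \<open>P\<close> relative to \<open>Q\<close>, in bits. The library constant takes the
  reference measure \<open>Q\<close> first.
\<close>

definition KL_bits :: "'a pmf \<Rightarrow> 'a pmf \<Rightarrow> real" where
  "KL_bits P Q = KL_divergence 2 (measure_pmf Q) (measure_pmf P)"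

text \<open>
  Hash values are drawn from an arbitrary nonempty finite set, without loss of generality a set of
  natural numbers. The hash function costs no space, so it is not part of the string produced by
  \<open>initialize\<close>; a query sees only this string and the hash value of the queried element.
\<close>

record filter_scheme =
  hash_range :: "nat set"
  initialize :: "nat set \<Rightarrow> (nat \<Rightarrow> nat) \<Rightarrow> bool list"
  query :: "bool list \<Rightarrow> nat \<Rightarrow> bool"

definition valid_scheme :: "filter_scheme \<Rightarrow> bool" where
  "valid_scheme S \<longleftrightarrow> finite (hash_range S) \<and> hash_range S \<noteq> {}"

text \<open>Independent uniform hash values on the universe \<open>{..<u}\<close>.\<close>

definition random_hash :: "filter_scheme \<Rightarrow> nat \<Rightarrow> (nat \<Rightarrow> nat) pmf" where
  "random_hash S u = Pi_pmf {..<u} undefined (\<lambda>_. pmf_of_set (hash_range S))"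

text \<open>The restriction ensures that initialization sees only the hash values of the keys.\<close>

definition filter_string :: "filter_scheme \<Rightarrow> nat set \<Rightarrow> (nat \<Rightarrow> nat) \<Rightarrow> bool list" where
  "filter_string S K h = initialize S K (restrict h K)"

definition false_negative_rate :: "filter_scheme \<Rightarrow> nat set \<Rightarrow> (nat \<Rightarrow> nat) \<Rightarrow> real" where
  "false_negative_rate S K h =
     \<P>(i in measure_pmf (pmf_of_set K). \<not> query S (filter_string S K h) (h i))"

definition false_positive_rate ::
    "filter_scheme \<Rightarrow> nat \<Rightarrow> nat set \<Rightarrow> bool list \<Rightarrow> nat \<Rightarrow> real" where
  "false_positive_rate S u K W i =
     \<P>(h in measure_pmf (random_hash S u).
         query S (filter_string S K h) (h i) \<bar> filter_string S K h = W)"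

definition filter_success ::
    "filter_scheme \<Rightarrow> nat \<Rightarrow> nat set \<Rightarrow> real \<Rightarrow> real \<Rightarrow> (nat \<Rightarrow> nat) \<Rightarrow> bool" where
  "filter_success S u K \<epsilon>K \<epsilon>N h \<longleftrightarrow>
     false_negative_rate S K h \<le> \<epsilon>K \<and>
     (\<forall>i\<in>{..<u} - K. false_positive_rate S u K (filter_string S K h) i = \<epsilon>N)"

end

theory Submission
  imports Defs "HOL-Real_Asymp.Real_Asymp"
begin

text \<open>
  Random coding: a hash value is a uniformly random function from the binary strings of length \<open>m\<close>
  to \<open>{..<q}\<close>, and the string \<open>W\<close> accepts an element iff the function given by its hash value
  vanishes at \<open>W\<close>. A non-key is thus accepted with probability exactly \<open>1 / q\<close>, whatever \<open>W\<close> is.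
  A fixed \<open>W\<close> rejects exactly \<open>r = \<lfloor>\<epsilon>K * n\<rfloor>\<close> keys with probability
  \<open>p = (n choose r) * (q - 1) ^ r / q ^ n\<close>, which is at least \<open>2 powr (- n * KL) / (n + 1)\<close> with
  \<open>KL\<close> the divergence at \<open>r / n\<close>, and these events are independent for different \<open>W\<close>. So once
  \<open>m \<ge> n * KL + 2 * log 2 (n + 1)\<close>, some \<open>W\<close> is suitable except with probability
  \<open>(1 - p) ^ 2 ^ m \<le> exp (- n)\<close>.
\<close>

text \<open>Both distributions are densities over the counting measure on \<open>bool\<close>, so
  the divergence is a two-term sum. The bounds on \<open>b\<close> give absolute continuity; at
  \<open>a = 0\<close> or \<open>a = 1\<close> the factor \<open>0\<close> removes the junk value of
  the logarithm.\<close>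

lemma KL_bits_bernoulli:
  assumes "0 \<le> a" "a \<le> 1" "0 < b" "b < 1"
  shows "KL_bits (bernoulli_pmf a) (bernoulli_pmf b) =
    a * log 2 (a / b) + (1 - a) * log 2 ((1 - a) / (1 - b))"
proof -
  interpret sigma_finite_measure "count_space (UNIV :: bool set)"
    by (intro sigma_finite_measure_count_space_countable) auto
  show ?thesis
    unfolding KL_bits_def measure_pmf_eq_density
    using assms
    by (subst KL_density_density) (auto simp: AE_count_space
        lebesgue_integral_count_space_finite UNIV_bool)
qed

section \<open>Independence of a non-key's hash value from the filter string\<close>

lemma prob_pair_pmf_Times:
  "measure_pmf.prob (pair_pmf M N) (A \<times> B) = measure_pmf.prob M A * measure_pmf.prob N B"
proof -
  have "measure_pmf.prob (pair_pmf M N) (A \<times> B) =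
      measure_pmf.prob (pair_pmf M N) (A \<times> B \<inter> set_pmf (pair_pmf M N))"
    by (simp only: measure_Int_set_pmf)
  \<comment> \<open>Cutting down to the supports makes both factors countable, as the product rule
    below requires.\<close>
  also have "A \<times> B \<inter> set_pmf (pair_pmf M N) = (A \<inter> set_pmf M) \<times> (B \<inter> set_pmf N)"
    by auto
  also have "measure_pmf.prob (pair_pmf M N) \<dots> = measure_pmf.prob M A * measure_pmf.prob N B"
    by (subst measure_pmf_prob_product) (simp_all add: measure_Int_set_pmf)
  finally show ?thesis .
qed

lemma map_pmf_random_hash_non_key:
  assumes "K \<subseteq> {..<u}" "i \<in> {..<u} - K"
  shows "map_pmf (\<lambda>h. (h i, restrict h K)) (random_hash S u) =
    pair_pmf (pmf_of_set (hash_range S)) (Pi_pmf K undefined (\<lambda>_. pmf_of_set (hash_range S)))"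
proof -
  let ?U = "\<lambda>_::nat. pmf_of_set (hash_range S)"
  let ?g = "\<lambda>h :: nat \<Rightarrow> nat. (h i, restrict h K)"
  have K: "finite K" "i \<notin> K" and iK: "insert i K \<subseteq> {..<u}"
    using assms finite_subset by auto
  have "map_pmf ?g (random_hash S u) = map_pmf ?g (Pi_pmf (insert i K) undefined ?U)"
    unfolding random_hash_def Pi_pmf_subset[OF finite_lessThan iK] map_pmf_comp
    by (intro map_pmf_cong refl) (auto simp: restrict_def)
  \<comment> \<open>Functions in the support of the \<open>Pi_pmf\<close> on \<open>K\<close> are
    \<open>undefined\<close> off \<open>K\<close>, so updating them at \<open>i\<close> and
    restricting to \<open>K\<close> gives them back.\<close>
  also have "\<dots> = map_pmf (\<lambda>x. x) (pair_pmf (?U i) (Pi_pmf K undefined ?U))"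
    unfolding Pi_pmf_insert[OF K] map_pmf_comp
    using set_Pi_pmf_subset[OF K(1), of undefined ?U] K
    by (intro map_pmf_cong refl) (auto simp: restrict_def fun_eq_iff subset_iff split: prod.splits)
  finally show ?thesis
    by simp
qed

text \<open>The string is a function of the hash values on \<open>K\<close>, which are independent
  of \<open>h i\<close>; conditioning on it therefore leaves \<open>h i\<close> uniform.\<close>

lemma false_positive_rate_eq:
  assumes "K \<subseteq> {..<u}" "i \<in> {..<u} - K" "h \<in> set_pmf (random_hash S u)"
  defines "W \<equiv> filter_string S K h"
  shows "false_positive_rate S u K W i =
    measure_pmf.prob (pmf_of_set (hash_range S)) {x. query S W x}"
proof -
  let ?U = "pmf_of_set (hash_range S)"
  let ?P = "Pi_pmf K undefined (\<lambda>_. ?U)"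
  let ?I = "{f. initialize S K f = W}"
  let ?g = "\<lambda>h :: nat \<Rightarrow> nat. (h i, restrict h K)"
  have prob: "measure_pmf.prob (random_hash S u) {h. h i \<in> A \<and> filter_string S K h = W} =
      measure_pmf.prob ?U A * measure_pmf.prob ?P ?I" for A
  proof -
    have "measure_pmf.prob (random_hash S u) (?g -` (A \<times> ?I)) =
        measure_pmf.prob (pair_pmf ?U ?P) (A \<times> ?I)"
      unfolding map_pmf_random_hash_non_key[OF assms(1,2), symmetric] by simp
    also have "\<dots> = measure_pmf.prob ?U A * measure_pmf.prob ?P ?I"
      by (rule prob_pair_pmf_Times)
    finally show ?thesis
      by (simp add: vimage_def filter_string_def)
  qed
  \<comment> \<open>The event conditioned on contains a point of the support, so
    \<open>cond_prob\<close> does not divide by zero.\<close>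
  have "h \<in> {h. filter_string S K h = W}"
    by (simp add: W_def)
  then have "measure_pmf.prob (random_hash S u) {h. filter_string S K h = W} \<noteq> 0"
    using assms(3) by (auto simp: measure_pmf_zero_iff)
  moreover have "measure_pmf.prob (random_hash S u) {h. filter_string S K h = W} = measure_pmf.prob ?P ?I"
    using prob[of UNIV] by simp
  moreover have "{h. query S (filter_string S K h) (h i) \<and> filter_string S K h = W} =
      {h. h i \<in> {x. query S W x} \<and> filter_string S K h = W}"
    by auto
  ultimately show ?thesis
    by (simp add: false_positive_rate_def cond_prob_def prob del: mem_Collect_eq)
qed

section \<open>Counting colourings by the number of nonzero values\<close>

text \<open>Sort the functions by their support \<open>A\<close>: each point of \<open>A\<close> has
  \<open>q - 1\<close> possible values, every other point only \<open>0\<close>.\<close>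

lemma card_functions_with_support_card:
  assumes "finite K" "0 < q"
  shows "card {c \<in> K \<rightarrow>\<^sub>E {..<q}. card {i \<in> K. c i \<noteq> 0} = r} = (card K choose r) * (q - 1) ^ r"
proof -
  let ?F = "\<lambda>A. {c \<in> K \<rightarrow>\<^sub>E {..<q}. {i \<in> K. c i \<noteq> 0} = A}"
  have F: "card (?F A) = (q - 1) ^ card A" if "A \<subseteq> K" for A
  proof -
    have "c \<in> ?F A \<longleftrightarrow> c \<in> (\<Pi>\<^sub>E i\<in>K. if i \<in> A then {0<..<q} else {0})" for c
    proof -
      have "(\<forall>i\<in>K. c i < q) \<and> {i \<in> K. c i \<noteq> 0} = A \<longleftrightarrow>
          (\<forall>i\<in>K. c i \<in> (if i \<in> A then {0<..<q} else {0}))"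
        using that assms(2) by (simp add: set_eq_iff subset_iff) (metis gr0I less_irrefl)
      then show ?thesis
        by (auto simp only: PiE_iff mem_Collect_eq lessThan_iff)
    qed
    then have "?F A = (\<Pi>\<^sub>E i\<in>K. if i \<in> A then {0<..<q} else {0})"
      by (rule set_eqI)
    then have "card (?F A) = (\<Prod>i\<in>K. if i \<in> A then q - 1 else 1)"
      using assms by (simp add: card_PiE if_distrib cong: if_cong)
    also have "\<dots> = (\<Prod>i\<in>A. q - 1)"
      using that assms by (simp add: prod.If_cases Int_absorb1)
    finally show ?thesis by simp
  qed
  have "{c \<in> K \<rightarrow>\<^sub>E {..<q}. card {i \<in> K. c i \<noteq> 0} = r} = (\<Union>A\<in>{A. A \<subseteq> K \<and> card A = r}. ?F A)"
    by auto
  also have "card \<dots> = (\<Sum>A\<in>{A. A \<subseteq> K \<and> card A = r}. card (?F A))"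
    using assms(1) by (intro card_UN_disjoint) (auto simp: finite_PiE)
  also have "\<dots> = (\<Sum>A\<in>{A. A \<subseteq> K \<and> card A = r}. (q - 1) ^ r)"
    using F by (intro sum.cong) (auto simp del: neq0_conv)
  also have "\<dots> = (card K choose r) * (q - 1) ^ r"
    using assms(1) by (simp add: n_subsets)
  finally show ?thesis .
qed

lemma bool_lists_of_length:
  "finite {W :: bool list. length W = m}" "card {W :: bool list. length W = m} = 2 ^ m"
  using finite_lists_length_eq[of "UNIV :: bool set" m] card_lists_length_eq[of "UNIV :: bool set" m]
  by simp_all

section \<open>The random-coding scheme\<close>

text \<open>Hash values have to be natural numbers, so the \<open>q ^ 2 ^ m\<close> functions on
  strings are numbered and \<open>decode\<close> recovers them. The parameter \<open>r\<close> is
  the number of rejected keys that is tolerated.\<close>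

locale random_code =
  fixes q m r :: nat and decode :: "nat \<Rightarrow> bool list \<Rightarrow> nat"
  assumes q: "2 \<le> q"
    and decode: "bij_betw decode {..<q ^ 2 ^ m} ({W. length W = m} \<rightarrow>\<^sub>E {..<q})"
begin

definition rejected :: "nat set \<Rightarrow> (nat \<Rightarrow> nat) \<Rightarrow> bool list \<Rightarrow> nat set" where
  "rejected K f W = {i \<in> K. decode (f i) W \<noteq> 0}"

text \<open>The default string is a junk value: any string of length \<open>m\<close> would do.\<close>

definition scheme :: filter_scheme where
  "scheme = \<lparr>hash_range = {..<q ^ 2 ^ m},
     initialize = \<lambda>K f.
       if \<exists>W. length W = m \<and> card (rejected K f W) \<le> r
       then SOME W. length W = m \<and> card (rejected K f W) \<le> r
       else replicate m False,
     query = \<lambda>W x. decode x W = 0\<rparr>"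

lemma hash_range_scheme: "hash_range scheme = {..<q ^ 2 ^ m}" "hash_range scheme \<noteq> {}"
  using q by (auto simp: scheme_def lessThan_empty_iff)

lemma query_scheme: "query scheme W x \<longleftrightarrow> decode x W = 0"
  by (simp add: scheme_def)

lemma rejected_restrict: "rejected K (restrict h K) W = rejected K h W"
  by (auto simp: rejected_def)

text \<open>Holds on failure too, so the space bound and the exact false positive rate have no
  exceptional event.\<close>

lemma length_filter_string: "length (filter_string scheme K h) = m"
  unfolding filter_string_def scheme_def
  using someI_ex[of "\<lambda>W. length W = m \<and> card (rejected K (restrict h K) W) \<le> r"] by auto

lemma card_rejected_filter_string:
  assumes "length W = m" "card (rejected K h W) \<le> r"
  shows "card (rejected K h (filter_string scheme K h)) \<le> r"
  unfolding filter_string_def scheme_def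
  using assms someI_ex[of "\<lambda>W. length W = m \<and> card (rejected K h W) \<le> r"]
  by (auto simp: rejected_restrict)

text \<open>The values of a uniformly random function are independent and uniform, so its value at
  the single point \<open>W\<close> is uniform on \<open>{..<q}\<close>.\<close>

lemma prob_query:
  assumes "length W = m"
  shows "measure_pmf.prob (pmf_of_set (hash_range scheme)) {x. query scheme W x} = 1 / real q"
proof -
  let ?L = "{W :: bool list. length W = m}"
  have "map_pmf decode (pmf_of_set (hash_range scheme)) = pmf_of_set (?L \<rightarrow>\<^sub>E {..<q})"
    using decode hash_range_scheme by (intro map_pmf_of_set_bij_betw) auto
  also have "?L \<rightarrow>\<^sub>E {..<q} = PiE_dflt ?L undefined (\<lambda>_. {..<q})"
    by (auto simp: PiE_dflt_def PiE_iff extensional_def)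
  also have "pmf_of_set \<dots> = Pi_pmf ?L undefined (\<lambda>_. pmf_of_set {..<q})"
    using q by (intro Pi_pmf_of_set[symmetric] bool_lists_of_length) (auto simp: lessThan_empty_iff)
  finally have "map_pmf (\<lambda>f. f W) (map_pmf decode (pmf_of_set (hash_range scheme))) =
      map_pmf (\<lambda>f. f W) (Pi_pmf ?L undefined (\<lambda>_. pmf_of_set {..<q}))"
    by (rule arg_cong)
  also have "\<dots> = pmf_of_set {..<q}"
    using assms by (subst Pi_pmf_component) (auto simp: bool_lists_of_length)
  finally have *: "map_pmf (\<lambda>x. decode x W) (pmf_of_set (hash_range scheme)) = pmf_of_set {..<q}"
    by (simp add: map_pmf_comp)
  have "measure_pmf.prob (pmf_of_set (hash_range scheme)) {x. query scheme W x} =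
      measure_pmf.prob (map_pmf (\<lambda>x. decode x W) (pmf_of_set (hash_range scheme))) {0}"
    by (simp add: vimage_def query_scheme)
  also have "\<dots> = 1 / real q"
    using q unfolding * by (subst measure_pmf_of_set) (auto simp: lessThan_empty_iff)
  finally show ?thesis .
qed

text \<open>Independence across strings is expressed by counting: failing hash functions on
  \<open>K\<close> inject into families of \<open>2 ^ m\<close> bad colourings.\<close>

lemma prob_all_strings_bad_le:
  assumes "K \<subseteq> {..<u}" "card K = n"
  shows "\<P>(h in measure_pmf (random_hash scheme u). \<forall>W. length W = m \<longrightarrow> r < card (rejected K h W))
    \<le> (1 - real (n choose r) * real (q - 1) ^ r / real q ^ n) ^ 2 ^ m" (is "?lhs \<le> _")
proof -
  let ?L = "{W :: bool list. length W = m}"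
  let ?R = "{..<q ^ 2 ^ m}"
  let ?C = "K \<rightarrow>\<^sub>E {..<q}"
  define Bad where "Bad = {c \<in> ?C. r < card {i \<in> K. c i \<noteq> 0}}"
  define Fail where "Fail = {f. \<forall>W. length W = m \<longrightarrow> r < card (rejected K f W)}"
  \<comment> \<open>Currying turns a hash function on \<open>K\<close> into one independent colouring of \<open>K\<close> per string;
    initialization fails iff all \<open>2 ^ m\<close> colourings are bad.\<close>
  define swap where "swap f = (\<lambda>W\<in>?L. \<lambda>i\<in>K. decode (f i) W)" for f
  have fK: "finite K" and R: "?R \<noteq> {}"
    using assms finite_subset q by (auto simp: lessThan_empty_iff)
  have dec: "decode x W < q" if "x < q ^ 2 ^ m" "length W = m" for x W
    using bij_betwE[OF decode] that by (auto simp: PiE_iff)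
  have inj: "inj_on swap (K \<rightarrow>\<^sub>E ?R)"
  proof
    fix f g assume fg: "f \<in> K \<rightarrow>\<^sub>E ?R" "g \<in> K \<rightarrow>\<^sub>E ?R" "swap f = swap g"
    show "f = g"
    proof (rule PiE_ext[OF fg(1,2)])
      fix i assume i: "i \<in> K"
      have "decode (f i) W = decode (g i) W" if "length W = m" for W
        using fun_cong[OF fun_cong[OF fg(3), of W], of i] that i by (simp add: swap_def)
      then have "decode (f i) = decode (g i)"
        using fg i bij_betwE[OF decode] by (intro PiE_ext[of _ ?L "\<lambda>_. {..<q}"]) auto
      then show "f i = g i"
        using fg i bij_betw_imp_inj_on[OF decode] by (auto dest: inj_onD)
    qed
  qed
  have fB: "finite Bad"
    unfolding Bad_def by (simp add: fK finite_PiE)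
  have "card (Fail \<inter> (K \<rightarrow>\<^sub>E ?R)) \<le> card (?L \<rightarrow>\<^sub>E Bad)"
  proof (rule card_inj_on_le)
    show "inj_on swap (Fail \<inter> (K \<rightarrow>\<^sub>E ?R))"
      using inj by (rule inj_on_subset) auto
    show "swap ` (Fail \<inter> (K \<rightarrow>\<^sub>E ?R)) \<subseteq> ?L \<rightarrow>\<^sub>E Bad"
      using dec by (fastforce simp: swap_def Bad_def Fail_def rejected_def PiE_iff cong: conj_cong)
    show "finite (?L \<rightarrow>\<^sub>E Bad)"
      using fB by (intro finite_PiE bool_lists_of_length)
  qed
  also have "\<dots> = card Bad ^ 2 ^ m"
    by (simp add: card_funcsetE bool_lists_of_length)
  finally have Fail: "card (Fail \<inter> (K \<rightarrow>\<^sub>E ?R)) \<le> card Bad ^ 2 ^ m" .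

  \<comment> \<open>Among the good colourings only those with exactly \<open>r\<close> nonzero
    values are counted; this single binomial term is what the entropy bound estimates.\<close>
  have "card Bad + card {c \<in> ?C. card {i \<in> K. c i \<noteq> 0} = r} =
      card (Bad \<union> {c \<in> ?C. card {i \<in> K. c i \<noteq> 0} = r})"
    using fB fK by (intro card_Un_disjoint[symmetric]) (auto simp: Bad_def finite_PiE)
  also have "\<dots> \<le> card ?C"
    using fK by (intro card_mono) (auto simp: Bad_def finite_PiE)
  also have "\<dots> = q ^ n"
    using fK assms by (simp add: card_funcsetE)
  finally have "card Bad + (n choose r) * (q - 1) ^ r \<le> q ^ n"
    using fK q assms by (simp add: card_functions_with_support_card del: neq0_conv)
  then have "real (card Bad + (n choose r) * (q - 1) ^ r) \<le> real (q ^ n)"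
    by (simp only: of_nat_le_iff)
  then have Bad: "real (card Bad) \<le> real q ^ n - real (n choose r) * real (q - 1) ^ r"
    by simp

  \<comment> \<open>Failure depends only on the hash values on \<open>K\<close>, whose joint law is
    uniform; here the universe size drops out of the bound.\<close>
  have "rejected K (\<lambda>i. if i \<in> K then h i else undefined) W = rejected K h W" for h W
    by (auto simp: rejected_def)
  then have "?lhs =
      measure_pmf.prob (map_pmf (\<lambda>h i. if i \<in> K then h i else undefined) (random_hash scheme u)) Fail"
    by (simp add: Fail_def vimage_def)
  also have "map_pmf (\<lambda>h i. if i \<in> K then h i else undefined) (random_hash scheme u) =
      pmf_of_set (PiE_dflt K undefined (\<lambda>_. ?R))"
    unfolding random_hash_def hash_range_scheme Pi_pmf_subset[OF finite_lessThan assms(1), symmetric]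
    by (rule Pi_pmf_of_set) (use R fK in auto)
  also have "PiE_dflt K undefined (\<lambda>_. ?R) = K \<rightarrow>\<^sub>E ?R"
    by (auto simp: PiE_dflt_def PiE_iff extensional_def)
  also have "measure_pmf.prob (pmf_of_set (K \<rightarrow>\<^sub>E ?R)) Fail =
      card (Fail \<inter> (K \<rightarrow>\<^sub>E ?R)) / card (K \<rightarrow>\<^sub>E ?R)"
    using R fK by (subst measure_pmf_of_set) (auto simp: PiE_eq_empty_iff finite_PiE Int_commute)
  also have "\<dots> \<le> real (card Bad ^ 2 ^ m) / card (K \<rightarrow>\<^sub>E ?R)"
    using Fail by (intro divide_right_mono) (simp_all only: of_nat_le_iff of_nat_0_le_iff)
  also have "card (K \<rightarrow>\<^sub>E ?R) = (q ^ n) ^ 2 ^ m"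
    using fK assms by (simp add: card_funcsetE flip: power_mult) (simp add: mult.commute)
  also have "real (card Bad ^ 2 ^ m) / real ((q ^ n) ^ 2 ^ m) = (real (card Bad) / real q ^ n) ^ 2 ^ m"
    by (simp add: power_divide)
  also have "\<dots> \<le> ((real q ^ n - real (n choose r) * real (q - 1) ^ r) / real q ^ n) ^ 2 ^ m"
    using Bad by (intro power_mono divide_right_mono) auto
  also have "\<dots> = (1 - real (n choose r) * real (q - 1) ^ r / real q ^ n) ^ 2 ^ m"
    using q by (simp add: diff_divide_distrib)
  finally show ?thesis .
qed

lemma filter_success_scheme:
  assumes "K \<subseteq> {..<u}" "card K = n" "1 \<le> n" "real r \<le> e * real n"
    and "h \<in> set_pmf (random_hash scheme u)" "length W = m" "card (rejected K h W) \<le> r"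
  shows "filter_success scheme u K e (1 / real q) h"
proof -
  let ?W = "filter_string scheme K h"
  have K: "finite K" "K \<noteq> {}"
    using assms finite_subset by auto
  have "false_negative_rate scheme K h = card (rejected K h ?W) / n"
    using K assms(2)
    by (simp add: false_negative_rate_def measure_pmf_of_set query_scheme rejected_def Collect_conj_eq)
  also have "\<dots> \<le> r / n"
    using card_rejected_filter_string[OF assms(6,7)] by (simp add: divide_right_mono)
  also have "\<dots> \<le> e"
    using assms by (simp add: field_simps)
  finally show ?thesis
    using false_positive_rate_eq[OF assms(1) _ assms(5)] prob_query length_filter_string
    by (simp add: filter_success_def)
qed

lemma prob_filter_success:
  assumes "K \<subseteq> {..<u}" "card K = n" "1 \<le> n" "real r \<le> e * real n"
  shows "\<P>(h in measure_pmf (random_hash scheme u). filter_success scheme u K e (1 / real q) h)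
    \<ge> 1 - (1 - real (n choose r) * real (q - 1) ^ r / real q ^ n) ^ 2 ^ m"
proof -
  let ?M = "measure_pmf (random_hash scheme u)"
  let ?G = "{h. \<exists>W. length W = m \<and> card (rejected K h W) \<le> r}"
  \<comment> \<open>The implication is available only for \<open>h\<close> in the support, hence
    monotonicity almost everywhere.\<close>
  have "measure ?M ?G \<le> \<P>(h in ?M. filter_success scheme u K e (1 / real q) h)"
    using filter_success_scheme[OF assms]
    by (intro measure_pmf.finite_measure_mono_AE) (auto simp: AE_measure_pmf_iff)
  moreover have "measure ?M ?G = 1 - measure ?M (UNIV - ?G)"
    using measure_pmf.prob_compl[of ?G "random_hash scheme u"] by simp
  moreover have "UNIV - ?G = {h. \<forall>W. length W = m \<longrightarrow> r < card (rejected K h W)}"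
    by (auto simp: not_le)
  ultimately show ?thesis
    using prob_all_strings_bad_le[OF assms(1,2)] by simp
qed

end

section \<open>Entropy bound for a binomial term and the failure probability\<close>

text \<open>The Poisson weights with mean \<open>r\<close> are maximal at \<open>r\<close>.\<close>

lemma power_div_fact_le:
  "real r ^ j / fact j \<le> real r ^ r / fact r"
proof (cases "j \<le> r")
  case True
  then show ?thesis
  proof (induction rule: inc_induct)
    case (step j)
    have "real r ^ j / fact j = real (Suc j) * real r ^ j / fact (Suc j)"
      by (simp del: of_nat_Suc)
    also have "\<dots> \<le> real r * real r ^ j / fact (Suc j)"
      using step by (intro divide_right_mono mult_right_mono) auto
    finally show ?case
      using step by simp
  qed simp
next
  case False
  then have "r \<le> j" by simp
  then show ?thesis
  proof (induction rule: dec_induct)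
    case (step j)
    have "real r ^ Suc j / fact (Suc j) = real r * real r ^ j / fact (Suc j)"
      by simp
    also have "\<dots> \<le> real (Suc j) * real r ^ j / fact (Suc j)"
      using step by (intro divide_right_mono mult_right_mono) auto
    also have "\<dots> = real r ^ j / fact j"
      by (simp del: of_nat_Suc)
    finally show ?case
      using step by simp
  qed simp
qed

text \<open>The term with index \<open>r\<close> is the largest one in the binomial expansion of \<open>(r + s) ^ n\<close>.\<close>

lemma binomial_ge_entropy:
  fixes r s :: nat
  defines "n \<equiv> r + s"
  shows "real n ^ n \<le> (real n + 1) * real (n choose r) * real r ^ r * real s ^ s"
proof -
  \<comment> \<open>Up to constant factors each term is a product of Poisson weights with means
    \<open>r\<close> and \<open>s\<close>, and both are maximal at \<open>k = r\<close>.\<close>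
  have eq: "real (n choose k) * real r ^ k * real s ^ (n - k) =
      fact n * ((real r ^ k / fact k) * (real s ^ (n - k) / fact (n - k)))" if "k \<le> n" for k
    using that by (simp add: binomial_fact)
  have "real n ^ n = (\<Sum>k\<le>n. real (n choose k) * real r ^ k * real s ^ (n - k))"
    unfolding n_def of_nat_add by (rule binomial_ring)
  also have "\<dots> \<le> (\<Sum>k\<le>n. real (n choose r) * real r ^ r * real s ^ s)"
  proof (rule sum_mono)
    fix k assume "k \<in> {..n}"
    then have "real (n choose k) * real r ^ k * real s ^ (n - k) \<le>
        fact n * ((real r ^ r / fact r) * (real s ^ s / fact s))"
      by (simp only: eq atMost_iff) (intro mult_left_mono mult_mono power_div_fact_le; simp)
    also have "\<dots> = real (n choose r) * real r ^ r * real s ^ s"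
      using eq[of r] by (simp add: n_def)
    finally show "real (n choose k) * real r ^ k * real s ^ (n - k) \<le>
        real (n choose r) * real r ^ r * real s ^ s" .
  qed
  finally show ?thesis
    by (simp add: mult.assoc add.commute)
qed

text \<open>At \<open>s = 0\<close> the factor \<open>0\<close> on the logarithm matches
  \<open>0 ^ 0 = 1\<close>, so the extreme cases \<open>r = 0\<close> and \<open>r = n\<close> need
  no separate treatment later.\<close>

lemma powr_minus_mult_log:
  assumes "0 < b"
  shows "2 powr (- (real s * log 2 (real s * b))) = 1 / (real s * b) ^ s"
proof (cases "s = 0")
  case False
  have "2 powr (- (real s * log 2 (real s * b))) = (2 powr (log 2 (real s * b))) powr (- real s)"
    by (simp add: powr_powr mult.commute)
  also have "\<dots> = 1 / (real s * b) ^ s"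
    using assms False by (simp add: powr_minus powr_realpow divide_inverse)
  finally show ?thesis .
qed simp

text \<open>
  \<open>cost q n r\<close> is \<open>n\<close> times the divergence of \<open>Bern((n - r) / n)\<close> from \<open>Bern(1 / q)\<close>.
\<close>

definition cost :: "nat \<Rightarrow> nat \<Rightarrow> nat \<Rightarrow> real" where
  "cost q n r =
     real (n - r) * log 2 (real (n - r) * (real q / real n)) +
     real r * log 2 (real r * (real q / (real n * real (q - 1))))"

text \<open>With \<open>s = n - r\<close>, the power of two equals
  \<open>n ^ n * (q - 1) ^ r / (q ^ n * r ^ r * s ^ s)\<close>; \<open>binomial_ge_entropy\<close>
  bounds \<open>n ^ n\<close> at the price of the factor \<open>n + 1\<close>.\<close>

lemma binomial_prob_ge_powr_cost:
  assumes "2 \<le> q" "r \<le> n" "1 \<le> n"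
  shows "2 powr (- cost q n r) / (real n + 1) \<le> real (n choose r) * real (q - 1) ^ r / real q ^ n"
proof -
  define s where "s = n - r"
  have n: "n = r + s"
    using assms by (simp add: s_def)
  define Q where "Q = real (q - 1)"
  have pos: "0 < real q" "0 < Q" "0 < real n"
    using assms by (auto simp: Q_def)
  have rs: "0 < real r ^ r * real s ^ s"
    by (cases "r = 0"; cases "s = 0") auto
  have "2 powr (- cost q n r) =
      2 powr (- (real s * log 2 (real s * (real q / real n)))) *
      2 powr (- (real r * log 2 (real r * (real q / (real n * Q)))))"
    by (simp add: cost_def s_def Q_def powr_add[symmetric])
  also have "\<dots> = 1 / (real s * (real q / real n)) ^ s * (1 / (real r * (real q / (real n * Q))) ^ r)"
    using pos by (subst (1 2) powr_minus_mult_log) auto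
  also have "\<dots> = real n ^ n * Q ^ r / (real q ^ n * (real r ^ r * real s ^ s))"
  proof -
    have split: "x ^ n = x ^ r * x ^ s" for x :: real
      by (simp add: n power_add)
    show ?thesis
      unfolding split using pos by (simp add: power_mult_distrib power_divide mult_ac)
  qed
  also have "\<dots> \<le> ((real n + 1) * real (n choose r) * real r ^ r * real s ^ s) * Q ^ r /
      (real q ^ n * (real r ^ r * real s ^ s))"
    using binomial_ge_entropy[of r s] pos rs
    by (intro divide_right_mono mult_right_mono) (auto simp: n)
  also have "\<dots> = ((real n + 1) * (real (n choose r) * Q ^ r)) * (real r ^ r * real s ^ s) /
      (real q ^ n * (real r ^ r * real s ^ s))"
    by (simp only: mult_ac)
  also have "\<dots> = (real n + 1) * (real (n choose r) * Q ^ r / real q ^ n)"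
    using rs by (subst nonzero_mult_divide_mult_cancel_right) auto
  finally show ?thesis
    by (simp add: Q_def divide_le_eq mult.commute)
qed

text \<open>The numerator is one term of the binomial expansion of
  \<open>((q - 1) + 1) ^ n\<close>.\<close>

lemma binomial_prob_le_1:
  assumes "1 \<le> q" "r \<le> n"
  shows "real (n choose r) * real (q - 1) ^ r / real q ^ n \<le> 1"
proof -
  have "(n choose r) * (q - 1) ^ r * 1 ^ (n - r) \<le> (\<Sum>k\<le>n. (n choose k) * (q - 1) ^ k * 1 ^ (n - k))"
    using assms by (intro member_le_sum) auto
  also have "\<dots> = ((q - 1) + 1) ^ n"
    by (subst binomial_ring) simp
  finally have "real ((n choose r) * (q - 1) ^ r) \<le> real (q ^ n)"
    using assms by (simp only: of_nat_le_iff) simp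
  then show ?thesis
    using assms by (simp add: divide_le_eq)
qed

text \<open>Guarantees that \<open>nat\<close> truncates nothing in the string length, so rounding
  up adds at most one bit. It follows because a probability is at most 1.\<close>

lemma cost_add_log_nonneg:
  assumes "2 \<le> q" "r \<le> n" "1 \<le> n"
  shows "0 \<le> cost q n r + 2 * log 2 (real n + 1)"
proof -
  have "2 powr (- cost q n r) / (real n + 1) \<le> 1"
    using binomial_prob_ge_powr_cost[OF assms] binomial_prob_le_1[of q r n] assms by linarith
  then have "2 powr (- cost q n r) \<le> 2 powr (log 2 (real n + 1))"
    by (simp add: divide_le_eq)
  then have "- cost q n r \<le> log 2 (real n + 1)"
    by (simp only: powr_le_cancel_iff one_less_numeral_iff semiring_norm)
  moreover have "0 \<le> log 2 (real n + 1)"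
    by simp
  ultimately show ?thesis
    by linarith
qed

text \<open>One of the two logarithms pays for the factor \<open>n + 1\<close> lost in
  \<open>p\<close>; the other raises \<open>p * 2 ^ m\<close>, the expected number of strings
  rejecting exactly \<open>r\<close> keys, to at least \<open>n\<close>. Then
  \<open>1 - p \<le> exp (- p)\<close> finishes.\<close>

lemma failure_le_exp:
  assumes "2 \<le> q" "r \<le> n" "1 \<le> n" "cost q n r + 2 * log 2 (real n + 1) \<le> real m"
  shows "(1 - real (n choose r) * real (q - 1) ^ r / real q ^ n) ^ 2 ^ m \<le> exp (- real n)"
proof -
  define p where "p = real (n choose r) * real (q - 1) ^ r / real q ^ n"
  have p: "2 powr (- cost q n r) / (real n + 1) \<le> p" "p \<le> 1"
    using binomial_prob_ge_powr_cost[of q r n] binomial_prob_le_1[of q r n] assms by (auto simp: p_def)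
  have "2 powr (cost q n r + 2 * log 2 (real n + 1)) = 2 powr cost q n r * ((real n + 1) * (real n + 1))"
    by (simp only: powr_add mult_2) simp
  then have "real n \<le> 2 powr (- cost q n r) / (real n + 1) * 2 powr (cost q n r + 2 * log 2 (real n + 1))"
    by (simp add: powr_minus flip: mult.assoc)
  also have "\<dots> \<le> p * 2 powr real m"
    using assms p by (intro mult_mono) (auto intro: order_trans[OF _ p(1)])
  finally have "real n \<le> p * 2 ^ m"
    by (simp add: powr_realpow)
  have "(1 - p) ^ 2 ^ m \<le> exp (- p) ^ 2 ^ m"
    using p exp_ge_add_one_self[of "- p"] by (intro power_mono) auto
  also have "\<dots> = exp (- (p * 2 ^ m))"
    by (simp flip: exp_of_nat_mult add: mult.commute)
  also have "\<dots> \<le> exp (- real n)"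
    using \<open>real n \<le> p * 2 ^ m\<close> by simp
  finally show ?thesis
    by (simp add: p_def)
qed

section \<open>Asymptotics of the string length\<close>

lemma tendsto_nat_floor_mult_div:
  fixes e :: real
  assumes "0 \<le> e"
  shows "(\<lambda>n. real (nat \<lfloor>e * real n\<rfloor>) / real n) \<longlonglongrightarrow> e"
proof (rule tendsto_sandwich)
  show "(\<lambda>n. e - 1 / real n) \<longlonglongrightarrow> e"
    by real_asymp
  show "(\<lambda>n. e) \<longlonglongrightarrow> e"
    by simp
  have fl: "e * real n - 1 \<le> real (nat \<lfloor>e * real n\<rfloor>)" "real (nat \<lfloor>e * real n\<rfloor>) \<le> e * real n" for n
    using assms by auto
  show "\<forall>\<^sub>F n in sequentially. e - 1 / real n \<le> real (nat \<lfloor>e * real n\<rfloor>) / real n"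
    using eventually_gt_at_top[of 0]
  proof eventually_elim
    case (elim n)
    then show ?case
      using divide_right_mono[OF fl(1), of "real n" n] by (simp add: diff_divide_distrib)
  qed
  show "\<forall>\<^sub>F n in sequentially. real (nat \<lfloor>e * real n\<rfloor>) / real n \<le> e"
    using eventually_gt_at_top[of 0] by eventually_elim (use fl in \<open>simp add: field_simps\<close>)
qed

lemma nat_floor_mult_le:
  fixes e :: real
  assumes "e \<le> 1"
  shows "nat \<lfloor>e * real n\<rfloor> \<le> n"
proof -
  have "\<lfloor>e * real n\<rfloor> \<le> \<lfloor>1 * real n\<rfloor>"
    using assms by (intro floor_mono mult_right_mono) auto
  then show ?thesis by simp
qed

lemma cost_rate_tendsto:
  fixes e :: real
  assumes "2 \<le> q" "0 \<le> e" "e < 1"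
  shows "(\<lambda>n. cost q n (nat \<lfloor>e * real n\<rfloor>) / real n) \<longlonglongrightarrow>
    KL_bits (bernoulli_pmf (1 - e)) (bernoulli_pmf (1 / real q))"
proof -
  define y where "y n = real (nat \<lfloor>e * real n\<rfloor>) / real n" for n
  have y: "y \<longlonglongrightarrow> e"
    unfolding y_def using assms(2) by (rule tendsto_nat_floor_mult_div)
  have KL: "KL_bits (bernoulli_pmf (1 - e)) (bernoulli_pmf (1 / real q)) =
      (1 - e) * log 2 ((1 - e) * real q) + e * log 2 (e * (real q / real (q - 1)))"
    using assms by (subst KL_bits_bernoulli) (auto simp: of_nat_diff field_simps)
  have x: "(\<lambda>n. (1 - y n) * log 2 ((1 - y n) * real q)) \<longlonglongrightarrow> (1 - e) * log 2 ((1 - e) * real q)"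
    using assms by (intro tendsto_intros y) auto
  \<comment> \<open>Continuity of the logarithm fails at argument \<open>0\<close>, but for
    \<open>e = 0\<close> the rounded count is exactly \<open>0\<close> for every \<open>n\<close>.
    The other summand is safe since \<open>e < 1\<close>.\<close>
  have "(\<lambda>n. y n * log 2 (y n * (real q / real (q - 1)))) \<longlonglongrightarrow> e * log 2 (e * (real q / real (q - 1)))"
  proof (cases "e = 0")
    case True
    then have "y n = 0" for n
      by (simp add: y_def)
    then show ?thesis
      using True by simp
  next
    case False
    then show ?thesis
      using assms by (intro tendsto_intros y) auto
  qed
  from tendsto_add[OF x this]
  have "(\<lambda>n. (1 - y n) * log 2 ((1 - y n) * real q) + y n * log 2 (y n * (real q / real (q - 1)))) \<longlonglongrightarrow>
      KL_bits (bernoulli_pmf (1 - e)) (bernoulli_pmf (1 / real q))"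
    by (simp add: KL)
  moreover have "\<forall>\<^sub>F n in sequentially.
      (1 - y n) * log 2 ((1 - y n) * real q) + y n * log 2 (y n * (real q / real (q - 1))) =
      cost q n (nat \<lfloor>e * real n\<rfloor>) / real n"
    using eventually_gt_at_top[of 0]
  proof eventually_elim
    case (elim n)
    let ?r = "nat \<lfloor>e * real n\<rfloor>"
    have "real (n - ?r) = (1 - y n) * real n" "real ?r = y n * real n"
      using elim nat_floor_mult_le[of e n] assms by (auto simp: y_def of_nat_diff field_simps)
    then show ?case
      using elim by (simp add: cost_def add_divide_distrib)
  qed
  ultimately show ?thesis
    by (rule Lim_transform_eventually)
qed

text \<open>The logarithmic slack and the rounding contribute \<open>O(log n / n)\<close> per key,
  so the limit is that of \<open>cost\<close>.\<close>

lemma string_length_rate_tendsto: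
  fixes e :: real
  assumes "2 \<le> q" "0 \<le> e" "e < 1"
  shows "(\<lambda>n. real (nat \<lceil>cost q n (nat \<lfloor>e * real n\<rfloor>) + 2 * log 2 (real n + 1)\<rceil>) / real n) \<longlonglongrightarrow>
    KL_bits (bernoulli_pmf (1 - e)) (bernoulli_pmf (1 / real q))" (is "?f \<longlonglongrightarrow> ?KL")
proof (rule tendsto_sandwich)
  let ?c = "\<lambda>n. cost q n (nat \<lfloor>e * real n\<rfloor>)"
  have "(\<lambda>n. 2 * log 2 (real n + 1) / real n) \<longlonglongrightarrow> 0"
    by real_asymp
  from tendsto_add[OF cost_rate_tendsto[OF assms] this]
  show lower: "(\<lambda>n. ?c n / real n + 2 * log 2 (real n + 1) / real n) \<longlonglongrightarrow> ?KL"
    by simp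
  from tendsto_add[OF lower lim_1_over_n]
  show "(\<lambda>n. ?c n / real n + 2 * log 2 (real n + 1) / real n + 1 / real n) \<longlonglongrightarrow> ?KL"
    by simp
  show "\<forall>\<^sub>F n in sequentially. ?c n / real n + 2 * log 2 (real n + 1) / real n \<le> ?f n"
    by (intro always_eventually allI)
      (simp add: divide_right_mono real_nat_ceiling_ge flip: add_divide_distrib)
  show "\<forall>\<^sub>F n in sequentially. ?f n \<le> ?c n / real n + 2 * log 2 (real n + 1) / real n + 1 / real n"
    using eventually_gt_at_top[of 0]
  proof eventually_elim
    case (elim n)
    have "0 \<le> ?c n + 2 * log 2 (real n + 1)"
      using elim assms nat_floor_mult_le[of e n] by (intro cost_add_log_nonneg) auto
    then have "real (nat \<lceil>?c n + 2 * log 2 (real n + 1)\<rceil>) \<le> ?c n + 2 * log 2 (real n + 1) + 1"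
      by linarith
    then show ?case
      by (simp add: divide_right_mono flip: add_divide_distrib)
  qed
qed

section \<open>Choice of parameters and conclusion\<close>

theorem theoremD2:
  fixes q :: nat and \<epsilon>K \<epsilon>N :: real
  assumes "primepow q" and "\<epsilon>N = 1 / real q" and "0 \<le> \<epsilon>K" and "\<epsilon>K < 1"
  shows "\<exists>(S :: nat \<Rightarrow> filter_scheme) (\<delta> :: nat \<Rightarrow> real) (\<eta> :: nat \<Rightarrow> real).
    (\<forall>n. valid_scheme (S n)) \<and> \<delta> \<longlonglongrightarrow> 0 \<and> \<eta> \<longlonglongrightarrow> 0 \<and>
    (\<forall>n u K. 1 \<le> n \<and> n \<le> u \<and> K \<subseteq> {..<u} \<and> card K = n \<longrightarrow>
      (\<forall>h \<in> set_pmf (random_hash (S n) u).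
         \<bar>real (length (filter_string (S n) K h)) / real n
            - KL_bits (bernoulli_pmf (1 - \<epsilon>K)) (bernoulli_pmf \<epsilon>N)\<bar> \<le> \<delta> n) \<and>
      \<P>(h in measure_pmf (random_hash (S n) u). filter_success (S n) u K \<epsilon>K \<epsilon>N h) \<ge> 1 - \<eta> n)"
proof -
  have q: "2 \<le> q"
    using primepow_gt_Suc_0[OF assms(1)] by simp
  \<comment> \<open>Rounding \<open>r\<close> down respects the false negative bound; rounding
    \<open>m\<close> up secures the failure bound.\<close>
  define r where "r n = nat \<lfloor>\<epsilon>K * real n\<rfloor>" for n
  define m where "m n = nat \<lceil>cost q n (r n) + 2 * log 2 (real n + 1)\<rceil>" for n
  define KL where "KL = KL_bits (bernoulli_pmf (1 - \<epsilon>K)) (bernoulli_pmf \<epsilon>N)"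
  have "\<exists>d. bij_betw d {..<q ^ 2 ^ m n} ({W :: bool list. length W = m n} \<rightarrow>\<^sub>E {..<q})" for n
    using ex_bij_betw_nat_finite[of "{W :: bool list. length W = m n} \<rightarrow>\<^sub>E {..<q}"]
    by (simp add: card_funcsetE finite_PiE bool_lists_of_length atLeast0LessThan)
  then obtain d where d: "bij_betw (d n) {..<q ^ 2 ^ m n} ({W :: bool list. length W = m n} \<rightarrow>\<^sub>E {..<q})" for n
    by metis
  interpret random_code q "m n" "r n" "d n" for n
    by unfold_locales (fact q, fact d)
  \<comment> \<open>The scheme is determined by \<open>n\<close> alone (with \<open>q\<close> and
    \<open>\<epsilon>K\<close> fixed), which gives uniformity in \<open>u\<close> and
    \<open>K\<close>.\<close>
  define S where "S n = random_code.scheme q (m n) (r n) (d n)" for n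
  have r: "r n \<le> n" "real (r n) \<le> \<epsilon>K * real n" for n
    using assms nat_floor_mult_le[of \<epsilon>K n] by (auto simp: r_def)
  have "(\<lambda>n. real (m n) / real n) \<longlonglongrightarrow> KL"
    unfolding m_def r_def KL_def assms(2) using q assms(3,4) by (rule string_length_rate_tendsto)
  then have "(\<lambda>n. \<bar>real (m n) / real n - KL\<bar>) \<longlonglongrightarrow> 0"
    by (simp add: tendsto_rabs_zero LIM_zero)
  moreover have "(\<lambda>n. exp (- real n)) \<longlonglongrightarrow> 0"
    by real_asymp
  moreover have "valid_scheme (S n)" for n
    using hash_range_scheme[of n] by (simp add: valid_scheme_def S_def)
  moreover have "\<P>(h in measure_pmf (random_hash (S n) u). filter_success (S n) u K \<epsilon>K \<epsilon>N h)
      \<ge> 1 - exp (- real n)"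
    if "1 \<le> n" "K \<subseteq> {..<u}" "card K = n" for n u K
  proof -
    have "cost q n (r n) + 2 * log 2 (real n + 1) \<le> real (m n)"
      by (simp add: m_def real_nat_ceiling_ge)
    then show ?thesis
      using prob_filter_success[OF that(2,3,1) r(2)] failure_le_exp[OF q r(1) that(1)]
      unfolding S_def assms(2) by fastforce
  qed
  moreover have "length (filter_string (S n) K h) = m n" for n K h
    by (simp add: S_def length_filter_string)
  ultimately show ?thesis
    unfolding KL_def
    \<comment> \<open>As all strings have length \<open>m n\<close>, the exact deviation of
      \<open>m n / n\<close> from the divergence serves as \<open>\<delta>\<close>.\<close>
    by (intro exI[of _ S] exI[of _ "\<lambda>n. \<bar>real (m n) / real n - KL\<bar>"]
        exI[of _ "\<lambda>n. exp (- real n)"]) (auto simp: KL_def)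
qed

end
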